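(* For any positive integers $b$ and $c$, there exists an acyclic digraph $D$ with $\chi(D)\ge c$ in which every oriented cycle (contained in $D$ as a subdigraph) has more than $b$ blocks.
   Context: Digraphs are finite, without loops or parallel arcs. A digraph is acyclic if it contains no directed cycle. The chromatic number $\chi(D)$ of a digraph $D$ is the chromatic number of its underlying undirected graph. An oriented cycle is an orientation of an undirected cycle. The blocks of a (non-directed) oriented cycle are its maximal directed subpaths (maximal sets of consecutive arcs all oriented in the same direction along the cycle). *)

theory Defs
  imports "Graph_Theory.Graph_Theory"
begin

text \<open>
  Digraphs are values of \<^typ>\<open>'a pair_pre_digraph\<close>, so parallel arcs are excluded by the type;
  the locale \<^locale>\<open>pair_digraph\<close> adds finiteness and the absence of loops.
  Undirected graphs are symmetric digraphs, and the underlying undirected graph of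
  a digraph is given by \<^const>\<open>mk_symmetric\<close>.
\<close>

definition acyclic_digraph :: "'a pair_pre_digraph \<Rightarrow> bool" where
  "acyclic_digraph D \<longleftrightarrow> \<not> (\<exists>p. pre_digraph.cycle (with_proj D) p)"

definition proper_colouring :: "'a pair_pre_digraph \<Rightarrow> nat \<Rightarrow> ('a \<Rightarrow> nat) \<Rightarrow> bool" where
  "proper_colouring G k f \<longleftrightarrow>
     (\<forall>v \<in> pverts G. f v < k) \<and> (\<forall>(u, v) \<in> parcs G. f u \<noteq> f v)"

definition graph_chromatic_number :: "'a pair_pre_digraph \<Rightarrow> nat" where
  "graph_chromatic_number G = (LEAST k. \<exists>f. proper_colouring G k f)"

definition digraph_chromatic_number :: "'a pair_pre_digraph \<Rightarrow> nat" where
  "digraph_chromatic_number D = graph_chromatic_number (mk_symmetric (with_proj D))"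

definition undirected_cycle :: "'a pair_pre_digraph \<Rightarrow> bool" where
  "undirected_cycle G \<longleftrightarrow>
     (\<exists>vs. 3 \<le> length vs \<and> distinct vs \<and> pverts G = set vs \<and>
       parcs G = (\<Union>i<length vs.
         {(vs ! i, vs ! (Suc i mod length vs)), (vs ! (Suc i mod length vs), vs ! i)}))"

text \<open>
  Antisymmetry says that every edge of the underlying cycle receives exactly one direction.
\<close>
definition oriented_cycle :: "'a pair_pre_digraph \<Rightarrow> bool" where
  "oriented_cycle C \<longleftrightarrow> antisym (parcs C) \<and> undirected_cycle (mk_symmetric (with_proj C))"

text \<open>
  A directed subpath is identified with its set of arcs. The set \<open>blocks C\<close> is meaningful
  for an oriented cycle \<open>C\<close> that is not a directed cycle; an acyclic digraph contains no
  other oriented cycles.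
\<close>
definition directed_subpaths :: "'a pair_pre_digraph \<Rightarrow> ('a \<times> 'a) set set" where
  "directed_subpaths C =
     {set p | u p v. pre_digraph.apath (with_proj C) u p v \<and> p \<noteq> []}"

definition blocks :: "'a pair_pre_digraph \<Rightarrow> ('a \<times> 'a) set set" where
  "blocks C =
     {P \<in> directed_subpaths C. \<forall>Q \<in> directed_subpaths C. P \<subseteq> Q \<longrightarrow> P = Q}"

end

theory Submission
  imports Defs "HOL-Library.Countable"
begin

text \<open>
  The digraph comes from the construction of Descartes. Take a digraph \<open>A\<close> on a vertex set \<open>V\<close>
  that is not \<open>c\<close>-colourable, and a \<open>card V\<close>-uniform hypergraph \<open>H\<close> that is not
  \<open>(c + 1)\<close>-colourable. For every edge of \<open>H\<close> add a new copy of \<open>A\<close>, and match the vertices of the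
  edge with the vertices of the copy by arcs directed from the edge to the copy. In every
  \<open>(c + 1)\<close>-colouring some edge of \<open>H\<close> is monochromatic, so one colour is missing on its copy;
  hence the result is not \<open>(c + 1)\<close>-colourable.

  Every vertex of \<open>H\<close> is now a source. A cycle either stays in one copy, where induction applies,
  or it passes through vertices of \<open>H\<close> and the edges whose copies it visits contain a Berge cycle.
  If \<open>H\<close> has girth more than \<open>b\<close>, the second kind of cycle visits more than \<open>b\<close> copies, and each visit
  is preceded by a source of its own. So by induction every cycle has more than \<open>b\<close> sources
  (\<open>uncolourable_many_sources\<close>). An arc that leaves a source of the cycle can only be the first arc
  of its block, so there are at least as many blocks as sources (\<open>card_sources_le_card_blocks\<close>).

  The hypergraphs of large girth and large chromatic number come from the partite amalgamation
  of Nesetril and Rodl (\<open>high_girth_unavoidable\<close>). Its start is a disjoint union of edges with a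
  projection to \<open>{..<c * r}\<close> under which every \<open>r\<close>-subset is covered: if every part is
  monochromatic, so is some edge. The parts are then treated one after the other. To deal with
  part \<open>k\<close>, take a hypergraph whose edges have the size of that part and whose girth may be smaller
  by one, and glue one copy of the present hypergraph to each of its edges along part \<open>k\<close>. In every
  colouring some copy then has a monochromatic part \<open>k\<close>. The girth does not drop: a Berge cycle
  through several copies induces a cycle in the hypergraph along which they are glued, and a copy
  that contributes only one edge meets part \<open>k\<close> in at most one vertex.
\<close>

section \<open>Hypergraphs of large girth\<close>

text \<open>
  A hypergraph is a set of edges, and an edge is a list of distinct vertices. Lists are used because
  they name the vertices of an edge by their positions, which is how copies of another structure
  are attached to it, and because edges remain countable and so can index vertices of type \<open>nat\<close>.
\<close>

definition leaf :: "'a list set \<Rightarrow> 'a list \<Rightarrow> bool" where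
  "leaf F e \<longleftrightarrow> (\<exists>x. set e \<inter> \<Union>(set ` (F - {e})) \<subseteq> {x})"

text \<open>
  This says that there is no Berge cycle of length at most \<open>g\<close>. The edges of a Berge cycle contain no
  leaf, and a Berge forest with at least two edges has at least two of them. Asking for two
  leaves rather than one makes the condition survive gluing: a leaf of one copy may be lost by
  attaching the rest of the hypergraph at a vertex, but not both.
\<close>
definition high_girth :: "nat \<Rightarrow> 'a list set \<Rightarrow> bool" where
  "high_girth g H \<longleftrightarrow> (\<forall>F. F \<subseteq> H \<and> 2 \<le> card F \<and> card F \<le> g \<longrightarrow>
     (\<exists>e\<in>F. \<exists>e'\<in>F. e \<noteq> e' \<and> leaf F e \<and> leaf F e'))"

definition unavoidable :: "nat \<Rightarrow> 'a list set \<Rightarrow> bool" where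
  "unavoidable c H \<longleftrightarrow> (\<forall>f::'a \<Rightarrow> nat. (\<forall>x. f x < c) \<longrightarrow>
     (\<exists>e\<in>H. \<forall>x\<in>set e. \<forall>y\<in>set e. f x = f y))"

definition uniform :: "nat \<Rightarrow> 'a list set \<Rightarrow> bool" where
  "uniform r H \<longleftrightarrow> (\<forall>e\<in>H. distinct e \<and> length e = r)"

lemma leafI: "set e \<inter> \<Union>(set ` (F - {e})) \<subseteq> {x} \<Longrightarrow> leaf F e"
  by (auto simp: leaf_def)

lemma leaf_map:
  assumes "inj_on h (\<Union>(set ` F))" and "e \<in> F" and "leaf F e"
  shows "leaf (map h ` F) (map h e)"
proof -
  obtain x where x: "set e \<inter> \<Union>(set ` (F - {e})) \<subseteq> {x}"
    using assms(3) by (auto simp: leaf_def)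
  show ?thesis
  proof (rule leafI[where x="h x"], rule subsetI)
    fix z assume "z \<in> set (map h e) \<inter> \<Union>(set ` (map h ` F - {map h e}))"
    then obtain e' where e': "z \<in> set (map h e)" "e' \<in> F" "map h e' \<noteq> map h e"
      "z \<in> set (map h e')" by blast
    then obtain u u' where u: "u \<in> set e" "z = h u" "u' \<in> set e'" "z = h u'" by auto
    have "u = u'"
      by (rule inj_onD[OF assms(1)]) (use u e'(2) assms(2) in auto)
    moreover have "e' \<noteq> e" using e'(3) by blast
    ultimately have "u \<in> set e \<inter> \<Union>(set ` (F - {e}))" using u e'(2) by blast
    then show "z \<in> {h x}" using x u(2) by blast
  qed
qed

lemma high_girth_map:
  assumes "inj_on h (\<Union>(set ` H))" and "high_girth g H"
    and F: "F \<subseteq> map h ` H" "2 \<le> card F" "card F \<le> g"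
  shows "\<exists>e\<in>F. \<exists>e'\<in>F. e \<noteq> e' \<and> leaf F e \<and> leaf F e'"
proof -
  obtain F0 where F0: "F0 \<subseteq> H" "F = map h ` F0" using F(1) by (auto simp: subset_image_iff)
  have inj: "inj_on h (\<Union>(set ` F0))" by (rule inj_on_subset[OF assms(1)]) (use F0 in auto)
  have injm: "inj_on (map h) F0"
  proof (rule inj_onI)
    fix x y assume "x \<in> F0" "y \<in> F0" "map h x = map h y"
    moreover from this have "inj_on h (set x \<union> set y)" by (intro inj_on_subset[OF inj]) auto
    ultimately show "x = y" by (simp add: inj_on_map_eq_map)
  qed
  then have "card F0 = card F" using F0 by (simp add: card_image)
  then obtain e e' where "e \<in> F0" "e' \<in> F0" "e \<noteq> e'" "leaf F0 e" "leaf F0 e'"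
    using assms(2) F F0 unfolding high_girth_def by metis
  then show ?thesis using leaf_map[OF inj] F0 injm by (metis image_eqI inj_onD)
qed

lemma monochromatic_list:
  fixes f :: "nat \<Rightarrow> nat"
  assumes "\<And>x. f x < c"
  shows "\<exists>e. distinct e \<and> length e = r \<and> set e \<subseteq> {..<c * r} \<and>
    (\<forall>x\<in>set e. \<forall>y\<in>set e. f x = f y)"
proof (cases "r = 0")
  case False
  have "\<exists>k<c. r \<le> card {x\<in>{..<c*r}. f x = k}"
  proof (rule ccontr)
    assume "\<not> ?thesis"
    then have small: "card {x\<in>{..<c*r}. f x = k} \<le> r - 1" if "k < c" for k using that by force
    have "{..<c*r} = (\<Union>k\<in>{..<c}. {x\<in>{..<c*r}. f x = k})" using assms by auto
    then have "c * r \<le> (\<Sum>k<c. card {x\<in>{..<c*r}. f x = k})"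
      by (metis card_UN_le card_lessThan finite_lessThan)
    also have "\<dots> \<le> c * (r - 1)"
      using sum_bounded_above[of "{..<c}" "\<lambda>k. card {x\<in>{..<c*r}. f x = k}" "r - 1"] small by simp
    also have "\<dots> < c * r" using assms[of 0] False by simp
    finally show False by simp
  qed
  then obtain k where "r \<le> card {x\<in>{..<c*r}. f x = k}" by blast
  then obtain S where S: "S \<subseteq> {x\<in>{..<c*r}. f x = k}" "card S = r" "finite S"
    by (rule obtain_subset_with_card_n) auto
  then obtain e where "set e = S" "distinct e" using finite_distinct_list by blast
  then show ?thesis using S by (intro exI[of _ e]) (auto simp: distinct_card[symmetric])
qed auto

section \<open>Gluing copies along a hypergraph\<close>

definition base_vertex :: "nat \<Rightarrow> nat" where
  "base_vertex x = to_nat (Inl x :: nat + nat list \<times> nat)"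

definition copy_vertex :: "nat list \<Rightarrow> nat \<Rightarrow> nat" where
  "copy_vertex E x = to_nat (Inr (E, x) :: nat + nat list \<times> nat)"

lemma vertex_simps [simp]:
  "base_vertex x = base_vertex y \<longleftrightarrow> x = y"
  "copy_vertex E x = copy_vertex E' y \<longleftrightarrow> E = E' \<and> x = y"
  "base_vertex x \<noteq> copy_vertex E y"
  "copy_vertex E y \<noteq> base_vertex x"
  by (auto simp: base_vertex_def copy_vertex_def)

text \<open>
  In the copy of a hypergraph that belongs to the edge \<open>E\<close>, the vertices of part \<open>k\<close> are identified
  with the vertices of \<open>E\<close>, using the enumeration \<open>\<beta>\<close> of the part; the other vertices are new.
\<close>
definition glue :: "(nat \<Rightarrow> nat) \<Rightarrow> nat \<Rightarrow> (nat \<Rightarrow> nat) \<Rightarrow> nat list \<Rightarrow> nat \<Rightarrow> nat" where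
  "glue \<pi> k \<beta> E x = (if \<pi> x = k then base_vertex (E ! \<beta> x) else copy_vertex E x)"

definition amalgam :: "(nat \<Rightarrow> nat) \<Rightarrow> nat \<Rightarrow> (nat \<Rightarrow> nat) \<Rightarrow> nat list set \<Rightarrow> nat list set \<Rightarrow> nat list set" where
  "amalgam \<pi> k \<beta> H' H = (\<Union>E\<in>H'. map (glue \<pi> k \<beta> E) ` H)"

text \<open>
  The projection to parts after gluing along part \<open>k\<close>: new vertices keep the part they had in the
  hypergraph that is copied.
\<close>
definition part :: "(nat \<Rightarrow> nat) \<Rightarrow> nat \<Rightarrow> nat \<Rightarrow> nat" where
  "part \<pi> k v = (case (from_nat v :: nat + nat list \<times> nat) of Inl y \<Rightarrow> k | Inr (E, x) \<Rightarrow> \<pi> x)"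

lemma part_simps [simp]:
  "part \<pi> k (base_vertex y) = k"
  "part \<pi> k (copy_vertex E x) = \<pi> x"
  "part \<pi> k (glue \<pi> k \<beta> E x) = \<pi> x"
  by (auto simp: part_def base_vertex_def copy_vertex_def glue_def)

lemma inj_on_glue:
  assumes "inj_on \<beta> {x\<in>U. \<pi> x = k}" and "\<beta> ` {x\<in>U. \<pi> x = k} \<subseteq> {..<length E}" and "distinct E"
  shows "inj_on (glue \<pi> k \<beta> E) U"
proof (rule inj_onI)
  fix x y assume xy: "x \<in> U" "y \<in> U" "glue \<pi> k \<beta> E x = glue \<pi> k \<beta> E y"
  then have "\<pi> x = \<pi> y" by (metis part_simps(3))
  then show "x = y" using xy assms
    by (auto simp: glue_def nth_eq_iff_index_eq image_subset_iff inj_on_def split: if_splits)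
qed

text \<open>
  The edges in \<open>F\<close> are grouped into clusters by \<open>src\<close>. If a cluster is attached to the rest at the
  single vertex \<open>x\<close>, only an edge through \<open>x\<close> can stop being a leaf. Two leaves of the cluster that
  both contain \<open>x\<close> already share it, so it is not an additional vertex for them.
\<close>
lemma leaf_in_cluster:
  assumes E: "E \<in> src ` F"
    and sep: "\<And>e e'. \<lbrakk>e \<in> F; e' \<in> F; src e = E; src e' \<noteq> E\<rbrakk> \<Longrightarrow> set e \<inter> set e' \<subseteq> {x}"
    and inner: "card {e\<in>F. src e = E} \<noteq> 1 \<Longrightarrow>
      \<exists>e e'. e \<in> F \<and> e' \<in> F \<and> src e = E \<and> src e' = E \<and> e \<noteq> e' \<and>
        leaf {e\<in>F. src e = E} e \<and> leaf {e\<in>F. src e = E} e'"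
  shows "\<exists>e\<in>F. src e = E \<and> leaf F e"
proof (cases "card {e\<in>F. src e = E} = 1")
  case True
  then obtain e where e: "{e\<in>F. src e = E} = {e}" using card_1_singletonE by blast
  then have "e \<in> F" "src e = E" by auto
  moreover have "leaf F e"
  proof (rule leafI, rule subsetI)
    fix z assume "z \<in> set e \<inter> \<Union>(set ` (F - {e}))"
    then obtain e' where e': "e' \<in> F" "e' \<noteq> e" "z \<in> set e" "z \<in> set e'" by blast
    then have "src e' \<noteq> E" using e by blast
    then show "z \<in> {x}" using sep[of e e'] e' \<open>e \<in> F\<close> \<open>src e = E\<close> by blast
  qed
  ultimately show ?thesis by blast
next
  case False
  let ?G = "{e\<in>F. src e = E}"
  obtain e1 e2 where e: "e1 \<in> F" "e2 \<in> F" "src e1 = E" "src e2 = E" "e1 \<noteq> e2"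
    "leaf ?G e1" "leaf ?G e2" using inner[OF False] by (elim exE conjE) (rule that)
  obtain y1 where y1: "set e1 \<inter> \<Union>(set ` (?G - {e1})) \<subseteq> {y1}" using e(6) unfolding leaf_def by blast
  obtain y2 where y2: "set e2 \<inter> \<Union>(set ` (?G - {e2})) \<subseteq> {y2}" using e(7) unfolding leaf_def by blast
  have outer: "set e' \<inter> \<Union>(set ` (F - {e'})) \<subseteq> (set e' \<inter> {x}) \<union> (set e' \<inter> \<Union>(set ` (?G - {e'})))"
    if e': "e' \<in> ?G" for e'
  proof
    fix z assume "z \<in> set e' \<inter> \<Union>(set ` (F - {e'}))"
    then obtain d where d: "d \<in> F" "d \<noteq> e'" "z \<in> set e'" "z \<in> set d" by blast
    show "z \<in> (set e' \<inter> {x}) \<union> (set e' \<inter> \<Union>(set ` (?G - {e'})))"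
    proof (cases "src d = E")
      case True
      then show ?thesis using d by blast
    next
      case False
      then have "z \<in> {x}" using sep[of e' d] e' d by blast
      then show ?thesis using d(3) by blast
    qed
  qed
  \<comment> \<open>If both candidates contain the attaching vertex, then it is the one vertex that the
    first shares with its own cluster.\<close>
  consider "x \<notin> set e1" | "x \<notin> set e2" | "x \<in> set e1" "x \<in> set e2" by blast
  then show ?thesis
  proof cases
    case 1
    moreover have "e1 \<in> ?G" using e by blast
    ultimately have "set e1 \<inter> \<Union>(set ` (F - {e1})) \<subseteq> {y1}" using outer[of e1] y1 by blast
    then have "leaf F e1" by (rule leafI)
    then show ?thesis using e(1,3) by blast
  next
    case 2
    moreover have "e2 \<in> ?G" using e by blast
    ultimately have "set e2 \<inter> \<Union>(set ` (F - {e2})) \<subseteq> {y2}" using outer[of e2] y2 by blast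
    then have "leaf F e2" by (rule leafI)
    then show ?thesis using e(2,4) by blast
  next
    case 3
    have "e1 \<in> ?G" "e2 \<in> ?G - {e1}" using e(1-5) by auto
    then have "x \<in> set e1 \<inter> \<Union>(set ` (?G - {e1}))" using 3 by blast
    then have "x = y1" using y1 by blast
    then have "set e1 \<inter> \<Union>(set ` (F - {e1})) \<subseteq> {y1}"
      using outer[OF \<open>e1 \<in> ?G\<close>] y1 by blast
    then have "leaf F e1" by (rule leafI)
    then show ?thesis using e(1,3) by blast
  qed
qed

text \<open>
  Let \<open>F\<close> be a set of edges of the amalgam, and group it by the copies to which they belong. Copies
  meet only in vertices of \<open>H'\<close>, and each edge has at most one of these, so an edge that is
  alone in its copy is a leaf of \<open>F\<close>. If every edge is alone, this gives two leaves. If all edges lie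
  in the same copy, then the girth of \<open>H\<close> gives them. In the remaining case there are fewer copies
  than edges, so the girth of \<open>H'\<close> applies to them: each of two copies is attached to the others at
  a single vertex at most, and provides a leaf. This is why the girth of \<open>H'\<close> may be
  smaller by one. Edges have at least two vertices so that each determines its copy.
\<close>
lemma high_girth_amalgam:
  assumes H': "high_girth g H'" "uniform n H'"
    and H: "high_girth (Suc g) H" "\<And>e. e \<in> H \<Longrightarrow> distinct (map \<pi> e) \<and> 2 \<le> length e"
    and \<beta>: "inj_on \<beta> {x\<in>\<Union>(set ` H). \<pi> x = k}" "\<beta> ` {x\<in>\<Union>(set ` H). \<pi> x = k} \<subseteq> {..<n}"
  shows "high_girth (Suc g) (amalgam \<pi> k \<beta> H' H)"
  unfolding high_girth_def
proof (intro allI impI, elim conjE)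
  fix F assume F: "F \<subseteq> amalgam \<pi> k \<beta> H' H" "2 \<le> card F" "card F \<le> Suc g"
  have finF: "finite F" using F(2) by (metis card.infinite not_numeral_le_zero)
  let ?\<kappa> = "glue \<pi> k \<beta>"
  \<comment> \<open>Every edge leaves part \<open>k\<close>, so it has a new vertex, which names the copy.\<close>
  define src where "src e = (SOME E. \<exists>x. copy_vertex E x \<in> set e)" for e
  have src: "src (map (?\<kappa> E) e) = E" if "e \<in> H" for E e
  proof -
    have "\<exists>x\<in>set e. \<pi> x \<noteq> k"
    proof (rule ccontr)
      assume "\<not> ?thesis"
      then have "set (map \<pi> e) \<subseteq> {k}" by auto
      then have "card (set (map \<pi> e)) \<le> 1" by (metis card_mono card.empty card_insert_disjoint
          empty_iff finite.intros One_nat_def)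
      then show False using H(2)[OF that] by (simp only: distinct_card) simp
    qed
    then have "\<exists>x. copy_vertex E x \<in> set (map (?\<kappa> E) e)" by (force simp: glue_def)
    then have "\<exists>x. copy_vertex (src (map (?\<kappa> E) e)) x \<in> set (map (?\<kappa> E) e)"
      unfolding src_def by (rule someI)
    moreover have "E' = E" if "copy_vertex E' x \<in> set (map (?\<kappa> E) e)" for E' x
      using that by (auto simp: glue_def split: if_splits)
    ultimately show ?thesis by blast
  qed
  have cluster: "src e \<in> H' \<and> e \<in> map (?\<kappa> (src e)) ` H" if "e \<in> F" for e
    using that F(1) src by (fastforce simp: amalgam_def)
  have meet: "\<exists>y. z = base_vertex y \<and> y \<in> set (src e) \<inter> set (src e')"
    if e: "e \<in> F" "e' \<in> F" "src e \<noteq> src e'" "z \<in> set e" "z \<in> set e'" for e e' z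
  proof -
    obtain d where d: "d \<in> H" "e = map (?\<kappa> (src e)) d" using cluster[OF e(1)] by blast
    obtain d' where d': "d' \<in> H" "e' = map (?\<kappa> (src e')) d'" using cluster[OF e(2)] by blast
    obtain u where u: "u \<in> set d" "z = ?\<kappa> (src e) u" using d e(4) by (metis imageE list.set_map)
    obtain u' where u': "u' \<in> set d'" "z = ?\<kappa> (src e') u'" using d' e(5) by (metis imageE list.set_map)
    have pi: "\<pi> u = k" "\<pi> u' = k" using u u' e(3) by (auto simp: glue_def split: if_splits)
    have "src e ! \<beta> u \<in> set (src e)" "src e' ! \<beta> u' \<in> set (src e')"
      using \<beta>(2) u(1) u'(1) d(1) d'(1) pi cluster[OF e(1)] cluster[OF e(2)] H'(2)
      by (auto simp: uniform_def image_subset_iff intro!: nth_mem)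
    moreover have "z = base_vertex (src e ! \<beta> u)" "z = base_vertex (src e' ! \<beta> u')"
      using u(2) u'(2) pi unfolding glue_def by simp_all
    ultimately show ?thesis by auto
  qed
  have single: "leaf F e" if e: "e \<in> F" "\<And>e'. e' \<in> F \<Longrightarrow> src e' = src e \<Longrightarrow> e' = e" for e
  proof -
    obtain d where d: "d \<in> H" "e = map (?\<kappa> (src e)) d" using cluster[OF e(1)] by blast
    have "\<exists>x. set e \<inter> {v. part \<pi> k v = k} \<subseteq> {x}"
    proof (cases "\<exists>u\<in>set d. \<pi> u = k")
      case True
      then obtain u where u: "u \<in> set d" "\<pi> u = k" by blast
      have "u' = u" if "u' \<in> set d" "\<pi> u' = k" for u'
        using that u H(2)[OF d(1)] by (auto simp: distinct_map dest: inj_onD)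
      then have "set e \<inter> {v. part \<pi> k v = k} \<subseteq> {?\<kappa> (src e) u}"
        by (subst d(2)) auto
      then show ?thesis by blast
    next
      case False
      then have "set e \<inter> {v. part \<pi> k v = k} \<subseteq> {}" by (subst d(2)) auto
      then show ?thesis by blast
    qed
    then obtain x where x: "set e \<inter> {v. part \<pi> k v = k} \<subseteq> {x}" by blast
    have "set e \<inter> \<Union>(set ` (F - {e})) \<subseteq> {x}"
    proof
      fix z assume "z \<in> set e \<inter> \<Union>(set ` (F - {e}))"
      then obtain e' where e': "e' \<in> F" "e' \<noteq> e" "z \<in> set e'" "z \<in> set e" by auto
      then obtain y where "z = base_vertex y" using meet[of e e' z] e by metis
      then show "z \<in> {x}" using x e' by auto
    qed
    then show ?thesis by (rule leafI)
  qed
  have inner: "\<exists>e e'. e \<in> F \<and> e' \<in> F \<and> src e = E \<and> src e' = E \<and> e \<noteq> e' \<and>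
        leaf {e\<in>F. src e = E} e \<and> leaf {e\<in>F. src e = E} e'"
    if "E \<in> src ` F" "card {e\<in>F. src e = E} \<noteq> 1" for E
  proof -
    let ?G = "{e\<in>F. src e = E}"
    have "card ?G \<noteq> 0" using that(1) finF by auto
    then have "2 \<le> card ?G" using that(2) by linarith
    moreover have "card ?G \<le> Suc g" using card_mono[OF finF, of ?G] F(3) by auto
    moreover have "?G \<subseteq> map (?\<kappa> E) ` H" using cluster by blast
    moreover have "E \<in> H'" using cluster that(1) by blast
    then have "inj_on (?\<kappa> E) (\<Union>(set ` H))"
      using H'(2) \<beta> by (intro inj_on_glue) (auto simp: uniform_def)
    ultimately show ?thesis using high_girth_map[OF _ H(1), of "?\<kappa> E" ?G] by blast
  qed
  let ?S = "src ` F"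
  have S: "?S \<subseteq> H'" using cluster by blast
  have cardS: "card ?S \<le> card F" using finF by (rule card_image_le)
  consider "card ?S = card F" | "card ?S < card F" "card ?S = 1" | "card ?S < card F" "2 \<le> card ?S"
    using cardS F(2) finF by (cases "card ?S") fastforce+
  then show "\<exists>e\<in>F. \<exists>e'\<in>F. e \<noteq> e' \<and> leaf F e \<and> leaf F e'"
  proof cases
    case 1
    then have "inj_on src F" using finF by (simp add: eq_card_imp_inj_on)
    then have "leaf F e" if "e \<in> F" for e using single that by (metis inj_onD)
    moreover obtain e e' where "e \<in> F" "e' \<in> F" "e \<noteq> e'"
      using F(2) by (metis card_le_Suc0_iff_eq finF not_less_eq_eq numeral_2_eq_2)
    ultimately show ?thesis by blast
  next
    case 2
    obtain E where E: "?S = {E}" using 2(2) by (rule card_1_singletonE)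
    then have "{e\<in>F. src e = E} = F" by auto
    then show ?thesis using inner[of E] E F(2) by auto
  next
    case 3
    then have "card ?S \<le> g" using F(3) by simp
    then obtain E1 E2 where E: "E1 \<in> ?S" "E2 \<in> ?S" "E1 \<noteq> E2" "leaf ?S E1" "leaf ?S E2"
      using H'(1) S 3(2) unfolding high_girth_def by blast
    have "\<exists>e\<in>F. src e = E \<and> leaf F e" if E: "E \<in> ?S" "leaf ?S E" for E
    proof -
      obtain y where y: "set E \<inter> \<Union>(set ` (?S - {E})) \<subseteq> {y}"
        using E by (auto simp: leaf_def)
      show ?thesis
      proof (rule leaf_in_cluster[OF E(1), where x="base_vertex y"])
        fix e e' assume e: "e \<in> F" "e' \<in> F" "src e = E" "src e' \<noteq> E"
        show "set e \<inter> set e' \<subseteq> {base_vertex y}"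
        proof
          fix z assume "z \<in> set e \<inter> set e'"
          then obtain y' where y': "z = base_vertex y'" "y' \<in> set (src e) \<inter> set (src e')"
            using meet[of e e' z] e by auto
          then have "y' \<in> set E \<inter> \<Union>(set ` (?S - {E}))" using e by auto
          then show "z \<in> {base_vertex y}" using y y' by auto
        qed
      qed (rule inner[OF E(1)])
    qed
    then show ?thesis using E by metis
  qed
qed

section \<open>Hypergraphs of large girth and large chromatic number\<close>

text \<open>
  The last condition is the chromatic property once the parts below \<open>k\<close> have been treated: only
  colourings that are constant on each of the remaining parts are known to have a monochromatic
  edge. At stage \<open>0\<close> this is the pigeonhole principle, and at stage \<open>c * r\<close> no part remains.
\<close>
definition partite_stage :: "nat \<Rightarrow> nat \<Rightarrow> nat \<Rightarrow> nat \<Rightarrow> (nat \<Rightarrow> nat) \<Rightarrow> nat list set \<Rightarrow> bool" where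
  "partite_stage g r c k \<pi> H \<longleftrightarrow> finite H \<and> high_girth g H \<and>
     (\<forall>e\<in>H. distinct (map \<pi> e) \<and> length e = r \<and> (\<forall>x\<in>set e. \<pi> x < c * r)) \<and>
     (\<forall>f::nat \<Rightarrow> nat. (\<forall>x. f x < c) \<and>
        (\<forall>x\<in>\<Union>(set ` H). \<forall>y\<in>\<Union>(set ` H). \<pi> x = \<pi> y \<and> k \<le> \<pi> x \<longrightarrow> f x = f y) \<longrightarrow>
        (\<exists>e\<in>H. \<forall>x\<in>set e. \<forall>y\<in>set e. f x = f y))"

lemma finite_distinct_lists: "finite {e. distinct e \<and> length e = r \<and> set e \<subseteq> {..<a::nat}}"
  by (rule finite_subset[OF _ finite_lists_length_eq[of "{..<a}" r]]) auto

lemma partite_stage_0: "\<exists>\<pi> H. partite_stage g r c 0 \<pi> H"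
proof -
  let ?K = "{e. distinct e \<and> length e = r \<and> set e \<subseteq> {..<c * r}}"
  let ?H = "(\<lambda>e. map (copy_vertex e) e) ` ?K"
  let ?\<pi> = "part id 0"
  have disj: "e = e'" if "e \<in> ?H" "e' \<in> ?H" "x \<in> set e" "x \<in> set e'" for e e' x
  proof -
    obtain d where d: "e = map (copy_vertex d) d" using \<open>e \<in> ?H\<close> by blast
    obtain d' where d': "e' = map (copy_vertex d') d'" using \<open>e' \<in> ?H\<close> by blast
    have "d = d'" using that(3,4) unfolding d d' by auto
    then show ?thesis using d d' by simp
  qed
  have leaf: "leaf F e" if F: "F \<subseteq> ?H" "e \<in> F" for F e
  proof (rule leafI[where x=0], rule subsetI)
    fix z assume "z \<in> set e \<inter> \<Union>(set ` (F - {e}))"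
    then obtain e' where "e' \<in> F" "e' \<noteq> e" "z \<in> set e" "z \<in> set e'" by blast
    moreover have "e \<in> ?H" "e' \<in> ?H" using F \<open>e' \<in> F\<close> by (simp_all only: subset_eq)
    ultimately show "z \<in> {0}" using disj[of e e' z] by simp
  qed
  have "high_girth g ?H"
    unfolding high_girth_def
  proof (intro allI impI, elim conjE)
    fix F assume F: "F \<subseteq> ?H" "2 \<le> card F"
    then have "finite F" by (metis card.infinite not_numeral_le_zero)
    then obtain e e' where "e \<in> F" "e' \<in> F" "e \<noteq> e'"
      using F(2) by (metis card_le_Suc0_iff_eq not_less_eq_eq numeral_2_eq_2)
    then show "\<exists>e\<in>F. \<exists>e'\<in>F. e \<noteq> e' \<and> leaf F e \<and> leaf F e'" 
      using leaf[OF F(1) \<open>e \<in> F\<close>] leaf[OF F(1) \<open>e' \<in> F\<close>] by blast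
  qed
  moreover have "\<forall>e\<in>?H. distinct (map ?\<pi> e) \<and> length e = r \<and> (\<forall>x\<in>set e. ?\<pi> x < c * r)"
    by (auto simp: o_def)
  moreover have "\<exists>e\<in>?H. \<forall>x\<in>set e. \<forall>y\<in>set e. f x = f y"
    if f: "\<forall>x. f x < c"
      "\<forall>x\<in>\<Union>(set ` ?H). \<forall>y\<in>\<Union>(set ` ?H). ?\<pi> x = ?\<pi> y \<and> 0 \<le> ?\<pi> x \<longrightarrow> f x = f y"
    for f :: "nat \<Rightarrow> nat"
  proof -
    \<comment> \<open>The colour of part \<open>i\<close>; an empty part gets the colour of an arbitrary vertex.\<close>
    define \<phi> where "\<phi> i = f (SOME x. x \<in> \<Union>(set ` ?H) \<and> ?\<pi> x = i)" for i
    have \<phi>: "f x = \<phi> (?\<pi> x)" if "x \<in> \<Union>(set ` ?H)" for x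
    proof -
      let ?y = "SOME y. y \<in> \<Union>(set ` ?H) \<and> ?\<pi> y = ?\<pi> x"
      have "?y \<in> \<Union>(set ` ?H) \<and> ?\<pi> ?y = ?\<pi> x" by (rule someI[of _ x]) (use that in blast)
      then show ?thesis unfolding \<phi>_def using f(2) that by (metis (no_types, lifting) le0)
    qed
    obtain e where e: "e \<in> ?K" "\<forall>x\<in>set e. \<forall>y\<in>set e. \<phi> x = \<phi> y"
      using monochromatic_list[of \<phi> c r] f(1) unfolding \<phi>_def by blast
    let ?e = "map (copy_vertex e) e"
    have eH: "?e \<in> ?H" using e(1) by blast
    have "f x = f y" if "x \<in> set ?e" "y \<in> set ?e" for x y
    proof -
      have "x \<in> \<Union>(set ` ?H)" "y \<in> \<Union>(set ` ?H)" using eH that by blast+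
      then have "f x = \<phi> (?\<pi> x)" "f y = \<phi> (?\<pi> y)" using \<phi> by blast+
      moreover have "?\<pi> x \<in> set e" "?\<pi> y \<in> set e" using that by auto
      then have "\<phi> (?\<pi> x) = \<phi> (?\<pi> y)" using e(2) by blast
      ultimately show ?thesis by (simp only:)
    qed
    then show ?thesis using eH by blast
  qed
  ultimately have "partite_stage g r c 0 ?\<pi> ?H"
    unfolding partite_stage_def using finite_distinct_lists by blast
  then show ?thesis by blast
qed

text \<open>
  Part \<open>k\<close> may be coloured arbitrarily now, because a colouring of the hypergraph along which the
  copies are glued has a monochromatic edge, and that edge is part \<open>k\<close> of its copy.
\<close>
lemma partite_stage_Suc:
  assumes smaller: "\<And>n. \<exists>H'::nat list set. finite H' \<and> uniform n H' \<and> high_girth g H' \<and> unavoidable c H'"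
    and r: "2 \<le> r" and stage: "partite_stage (Suc g) r c k \<pi> H"
  shows "\<exists>\<pi>' H'. partite_stage (Suc g) r c (Suc k) \<pi>' H'"
proof -
  let ?U = "\<Union>(set ` H)"
  let ?X = "{x\<in>?U. \<pi> x = k}"
  have H: "finite H" "high_girth (Suc g) H"
    "\<And>e. e \<in> H \<Longrightarrow> distinct (map \<pi> e) \<and> length e = r \<and> (\<forall>x\<in>set e. \<pi> x < c * r)"
    and ramsey: "\<And>f::nat \<Rightarrow> nat. (\<And>x. f x < c) \<Longrightarrow>
        (\<And>x y. \<lbrakk>x \<in> ?U; y \<in> ?U; \<pi> x = \<pi> y; k \<le> \<pi> x\<rbrakk> \<Longrightarrow> f x = f y) \<Longrightarrow>
        \<exists>e\<in>H. \<forall>x\<in>set e. \<forall>y\<in>set e. f x = f y"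
    using stage unfolding partite_stage_def by (blast, blast, blast, metis)
  have "finite ?X" using H(1) by auto
  then obtain \<beta> where "bij_betw \<beta> ?X {..<card ?X}"
    by (metis ex_bij_betw_finite_nat lessThan_atLeast0)
  then have \<beta>: "inj_on \<beta> ?X" "\<beta> ` ?X \<subseteq> {..<card ?X}" by (auto simp: bij_betw_def)
  obtain H' :: "nat list set" where H': "finite H'" "uniform (card ?X) H'" "high_girth g H'" "unavoidable c H'"
    using smaller by blast
  let ?A = "amalgam \<pi> k \<beta> H' H"
  let ?\<pi> = "part \<pi> k"
  have edges: "distinct (map ?\<pi> e) \<and> length e = r \<and> (\<forall>x\<in>set e. ?\<pi> x < c * r)" if e: "e \<in> ?A" for e
  proof -
    obtain E d where "d \<in> H" "e = map (glue \<pi> k \<beta> E) d"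
      using e unfolding amalgam_def by blast
    then show ?thesis using H(3)[of d] by (auto simp: o_def)
  qed
  have "high_girth (Suc g) ?A"
    by (rule high_girth_amalgam[OF H'(3,2) H(2) _ \<beta>]) (use H(3) r in auto)
  moreover have "\<exists>e\<in>?A. \<forall>x\<in>set e. \<forall>y\<in>set e. f x = f y"
    if f: "\<forall>x. f x < c"
      "\<forall>x\<in>\<Union>(set ` ?A). \<forall>y\<in>\<Union>(set ` ?A). ?\<pi> x = ?\<pi> y \<and> Suc k \<le> ?\<pi> x \<longrightarrow> f x = f y"
    for f :: "nat \<Rightarrow> nat"
  proof -
    have "\<forall>x. (f \<circ> base_vertex) x < c" using f(1) by simp
    then obtain E where E: "E \<in> H'"
      "\<forall>x\<in>set E. \<forall>y\<in>set E. (f \<circ> base_vertex) x = (f \<circ> base_vertex) y"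
      using H'(4) unfolding unavoidable_def by meson
    let ?h = "\<lambda>x. f (glue \<pi> k \<beta> E x)"
    have "\<exists>e\<in>H. \<forall>x\<in>set e. \<forall>y\<in>set e. ?h x = ?h y"
    proof (rule ramsey)
      show "?h x < c" for x using f(1) by simp
      fix x y assume xy: "x \<in> ?U" "y \<in> ?U" "\<pi> x = \<pi> y" "k \<le> \<pi> x"
      show "?h x = ?h y"
      proof (cases "\<pi> x = k")
        case True
        then have "\<beta> x < length E" "\<beta> y < length E"
          using xy \<beta>(2) H'(2) E(1) by (auto simp: uniform_def image_subset_iff)
        then show ?thesis using E(2) True xy(3) by (simp add: glue_def)
      next
        case False
        have "glue \<pi> k \<beta> E x \<in> \<Union>(set ` ?A)" if "x \<in> ?U" for x
          using that E(1) by (fastforce simp: amalgam_def)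
        then show ?thesis using f(2) xy False by (metis Suc_leI le_neq_implies_less part_simps(3))
      qed
    qed
    then obtain e where e: "e \<in> H" "\<forall>x\<in>set e. \<forall>y\<in>set e. ?h x = ?h y" by blast
    have "map (glue \<pi> k \<beta> E) e \<in> ?A" unfolding amalgam_def using E(1) e(1) by blast
    moreover have "\<forall>x\<in>set (map (glue \<pi> k \<beta> E) e). \<forall>y\<in>set (map (glue \<pi> k \<beta> E) e). f x = f y"
      unfolding list.set_map ball_simps using e(2) by fast
    ultimately show ?thesis by (rule bexI[rotated])
  qed
  moreover have "finite ?A" using H(1) H'(1) by (auto simp: amalgam_def)
  ultimately have "partite_stage (Suc g) r c (Suc k) ?\<pi> ?A"
    unfolding partite_stage_def using edges by blast
  then show ?thesis by blast
qed

theorem high_girth_unavoidable: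
  "\<exists>H::nat list set. finite H \<and> uniform r H \<and> high_girth g H \<and> unavoidable c H"
proof (induction g arbitrary: r)
  case 0
  let ?H = "{e. distinct e \<and> length e = r \<and> set e \<subseteq> {..<c * r}}"
  have "unavoidable c ?H" using monochromatic_list[of _ c r] unfolding unavoidable_def by blast
  moreover have "uniform r ?H" by (simp add: uniform_def)
  moreover have "high_girth 0 ?H" by (auto simp: high_girth_def)
  ultimately show ?case using finite_distinct_lists by blast
next
  case (Suc g)
  show ?case
  proof (cases "2 \<le> r")
    case True
    have "\<exists>\<pi> H. partite_stage (Suc g) r c k \<pi> H" for k
      by (induction k) (use partite_stage_0 partite_stage_Suc[OF Suc.IH True] in blast)+
    then obtain \<pi> H where "partite_stage (Suc g) r c (c * r) \<pi> H" by blast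
    then have H: "finite H" "high_girth (Suc g) H"
      "\<And>e. e \<in> H \<Longrightarrow> distinct (map \<pi> e) \<and> length e = r \<and> (\<forall>x\<in>set e. \<pi> x < c * r)"
      and ramsey: "\<And>f::nat \<Rightarrow> nat. (\<forall>x. f x < c) \<Longrightarrow>
          (\<forall>x\<in>\<Union>(set ` H). \<forall>y\<in>\<Union>(set ` H). \<pi> x = \<pi> y \<and> c * r \<le> \<pi> x \<longrightarrow> f x = f y) \<Longrightarrow>
          \<exists>e\<in>H. \<forall>x\<in>set e. \<forall>y\<in>set e. f x = f y"
      unfolding partite_stage_def by (blast, blast, blast, metis)
    have "unavoidable c H"
      unfolding unavoidable_def
    proof (intro allI impI)
      fix f :: "nat \<Rightarrow> nat" assume f: "\<forall>x. f x < c"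
      show "\<exists>e\<in>H. \<forall>x\<in>set e. \<forall>y\<in>set e. f x = f y"
        by (rule ramsey[OF f]) (use H(3) in \<open>fastforce simp: not_le[symmetric]\<close>)
    qed
    moreover have "uniform r H" using H(3) by (auto simp: uniform_def distinct_map)
    ultimately show ?thesis using H by blast
  next
    case False
    then have "r = 0 \<or> r = 1" by auto
    then have "distinct (replicate r (0::nat))" by auto
    then have "uniform r {replicate r (0::nat)}" by (simp add: uniform_def)
    moreover have "unavoidable c {replicate r (0::nat)}" by (auto simp: unavoidable_def)
    moreover have "high_girth (Suc g) {replicate r (0::nat)}"
      unfolding high_girth_def
    proof (intro allI impI, elim conjE)
      fix F :: "nat list set" assume "F \<subseteq> {replicate r 0}" "2 \<le> card F"
      then show "\<exists>e\<in>F. \<exists>e'\<in>F. e \<noteq> e' \<and> leaf F e \<and> leaf F e'"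
        using card_mono[of "{replicate r 0}" F] by simp
    qed
    ultimately show ?thesis by blast
  qed
qed

section \<open>Oriented cycles and their sources\<close>

text \<open>
  A cycle of the underlying graph is traversed by an \<open>n\<close>-periodic function on the natural numbers,
  which allows it to be followed from any starting point.
\<close>
definition cycle_walk :: "('a \<times> 'a) set \<Rightarrow> (nat \<Rightarrow> 'a) \<Rightarrow> nat \<Rightarrow> bool" where
  "cycle_walk A v n \<longleftrightarrow> 3 \<le> n \<and> (\<forall>i j. v i = v j \<longleftrightarrow> i mod n = j mod n) \<and>
     (\<forall>i. (v i, v (Suc i)) \<in> A \<or> (v (Suc i), v i) \<in> A)"

text \<open>
  The source itself is \<open>v (Suc i)\<close>, so that both neighbours have natural number indices.
\<close>
definition sources :: "('a \<times> 'a) set \<Rightarrow> (nat \<Rightarrow> 'a) \<Rightarrow> nat \<Rightarrow> nat set" where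
  "sources A v n = {i. i < n \<and> (v (Suc i), v i) \<in> A \<and> (v (Suc i), v (Suc (Suc i))) \<in> A}"

definition many_sources :: "nat \<Rightarrow> ('a \<times> 'a) set \<Rightarrow> bool" where
  "many_sources b A \<longleftrightarrow> (\<forall>v n. cycle_walk A v n \<longrightarrow> b < card (sources A v n))"

definition uncolourable :: "nat \<Rightarrow> ('a \<times> 'a) set \<Rightarrow> bool" where
  "uncolourable c A \<longleftrightarrow> (\<forall>f::'a \<Rightarrow> nat. (\<forall>x. f x < c) \<longrightarrow> (\<exists>(x, y)\<in>A. f x = f y))"

lemma mod_Suc_Suc_neq:
  fixes n :: nat
  assumes "3 \<le> n"
  shows "Suc (Suc i) mod n \<noteq> i mod n"
  using assms by (simp add: mod_Suc)

lemma cycle_walk_neq: "cycle_walk A v n \<Longrightarrow> v (Suc (Suc i)) \<noteq> v i"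
  unfolding cycle_walk_def using mod_Suc_Suc_neq by blast

lemma last_step_inside:
  fixes i j :: nat
  assumes "P i" and "\<not> P j" and "i \<le> j"
  shows "\<exists>k\<ge>i. P k \<and> \<not> P (Suc k)"
  using assms(3,2)
proof (induction j rule: dec_induct)
  case base
  then show ?case using assms(1) by simp
next
  case (step m)
  then show ?case by (cases "P m") auto
qed

section \<open>The construction of Descartes\<close>

definition descartes :: "nat list set \<Rightarrow> (nat \<Rightarrow> nat) \<Rightarrow> nat set \<Rightarrow> (nat \<times> nat) set \<Rightarrow> (nat \<times> nat) set" where
  "descartes H \<beta> V A =
     (\<Union>E\<in>H. (\<lambda>w. (base_vertex (E ! \<beta> w), copy_vertex E w)) ` V \<union>
             (\<lambda>(w, w'). (copy_vertex E w, copy_vertex E w')) ` A)"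

lemma descartes_simps:
  "(x, base_vertex y) \<notin> descartes H \<beta> V A"
  "(base_vertex y, copy_vertex E w) \<in> descartes H \<beta> V A \<longleftrightarrow> E \<in> H \<and> w \<in> V \<and> y = E ! \<beta> w"
  "(copy_vertex E w, copy_vertex E' w') \<in> descartes H \<beta> V A \<longleftrightarrow> E \<in> H \<and> E' = E \<and> (w, w') \<in> A"
  by (auto simp: descartes_def)

lemma descartes_vertex:
  assumes "(x, y) \<in> descartes H \<beta> V A"
  shows "(\<exists>z. x = base_vertex z) \<or> (\<exists>E w. x = copy_vertex E w)"
    and "\<exists>E w. y = copy_vertex E w"
  using assms by (auto simp: descartes_def)

text \<open>
  A cycle that uses base vertices enters each copy it visits from a base vertex, which is a source
  of the cycle; different copies give different sources. If there were at most \<open>b\<close> of these copies,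
  some edge \<open>E\<close> among theirs would share at most one vertex with the others. But the base vertices
  before entering and after leaving the copy at \<open>E\<close> each lie in a second edge, since a base vertex
  has only one neighbour in each copy.
\<close>
lemma descartes_many_sources:
  assumes girth: "high_girth b H" and unif: "uniform (card V) H"
    and \<beta>: "inj_on \<beta> V" "\<beta> ` V \<subseteq> {..<card V}" and A: "many_sources b A"
  shows "many_sources b (descartes H \<beta> V A)"
  unfolding many_sources_def
proof (intro allI impI)
  fix v n assume cyc: "cycle_walk (descartes H \<beta> V A) v n"
  let ?D = "descartes H \<beta> V A"
  have n: "3 \<le> n" and v_eq: "v i = v j \<longleftrightarrow> i mod n = j mod n"
    and arc: "(v i, v (Suc i)) \<in> ?D \<or> (v (Suc i), v i) \<in> ?D" for i j
    using cyc by (auto simp: cycle_walk_def)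
  define at_base where "at_base i \<longleftrightarrow> (\<exists>y. v i = base_vertex y)" for i
  define in_copy where "in_copy E i \<longleftrightarrow> (\<exists>w. v i = copy_vertex E w)" for E i
  have vertex: "at_base i \<or> (\<exists>E. in_copy E i)" for i
    using arc[of i] descartes_vertex unfolding at_base_def in_copy_def by blast
  have next_copy: "in_copy E (Suc i)" if "in_copy E i" "\<not> at_base (Suc i)" for E i
    using that vertex[of "Suc i"] arc[of i]
    by (auto simp: in_copy_def at_base_def descartes_simps)
  have next_copy': "at_base i" if "in_copy E (Suc i)" "\<not> in_copy E i" for E i
    using that vertex[of i] arc[of i]
    by (auto simp: in_copy_def at_base_def descartes_simps)
  have inj_edge: "w = w'" if "E \<in> H" "w \<in> V" "w' \<in> V" "E ! \<beta> w = E ! \<beta> w'" for E w w'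
  proof -
    have "distinct E" "\<beta> w < length E" "\<beta> w' < length E"
      using unif \<beta>(2) that(1-3) by (auto simp: uniform_def)
    then show ?thesis using that \<beta>(1) by (simp add: nth_eq_iff_index_eq inj_on_def)
  qed
  have in_edge: "E ! \<beta> w \<in> set E" if "E \<in> H" "w \<in> V" for E w
    using that unif \<beta>(2) by (intro nth_mem) (auto simp: uniform_def)
  show "b < card (sources ?D v n)"
  proof (cases "\<exists>i. at_base i")
    case False
    obtain E where "in_copy E 0" using vertex False by blast
    then have "in_copy E i" for i using next_copy False by (induction i) blast+
    then obtain u where u: "v i = copy_vertex E (u i)" for i
      unfolding in_copy_def by metis
    have E: "E \<in> H" using arc[of 0] u by (auto simp: descartes_simps)
    have "cycle_walk A u n"
      using cyc E by (simp add: cycle_walk_def u descartes_simps)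
    moreover have "sources A u n = sources ?D v n"
      using E by (simp add: sources_def u descartes_simps)
    ultimately show ?thesis using A unfolding many_sources_def by metis
  next
    case True
    then obtain i0 where i0: "at_base i0" by blast
    have around_base: "\<exists>E w E' w'. E \<in> H \<and> E' \<in> H \<and> w \<in> V \<and> w' \<in> V \<and>
        v i = copy_vertex E w \<and> v (Suc (Suc i)) = copy_vertex E' w' \<and>
        y = E ! \<beta> w \<and> y = E' ! \<beta> w' \<and> E \<noteq> E'"
      if y: "v (Suc i) = base_vertex y" for i y
    proof -
      have arcs: "(v (Suc i), v i) \<in> ?D" "(v (Suc i), v (Suc (Suc i))) \<in> ?D"
        using arc[of i] arc[of "Suc i"] y by (auto simp: descartes_simps)
      obtain E w E' w' where vv: "v i = copy_vertex E w" "v (Suc (Suc i)) = copy_vertex E' w'"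
        using descartes_vertex(2)[OF arcs(1)] descartes_vertex(2)[OF arcs(2)] by blast
      then have *: "E \<in> H" "w \<in> V" "y = E ! \<beta> w" "E' \<in> H" "w' \<in> V" "y = E' ! \<beta> w'"
        using arcs y by (auto simp: descartes_simps)
      have "E \<noteq> E'" using inj_edge[of E w w'] * vv cycle_walk_neq[OF cyc, of i] by auto
      then show ?thesis using * vv by blast
    qed
    let ?\<E> = "{E. \<exists>i. in_copy E i}"
    have enter: "\<exists>i<n. at_base (Suc i) \<and> in_copy E (Suc (Suc i))" if E: "E \<in> ?\<E>" for E
    proof -
      obtain j where "in_copy E j" using E by blast
      \<comment> \<open>Going round the cycle a few more times puts the visit to the copy after one to a base
        vertex, and the latter at a positive index.\<close>
      moreover have "v (j + (i0 + n) * n) = v j" "v (i0 + n) = v i0" by (simp_all add: v_eq)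
      ultimately have "\<not> \<not> in_copy E (j + (i0 + n) * n)" "\<not> in_copy E (i0 + n)"
        using i0 by (auto simp: in_copy_def at_base_def)
      moreover have "i0 + n \<le> j + (i0 + n) * n" using n by (simp add: trans_le_add2)
      ultimately obtain k where k: "i0 + n \<le> k" "\<not> in_copy E k" "in_copy E (Suc k)"
        using last_step_inside[of "\<lambda>k. \<not> in_copy E k"] by blast
      then obtain i where i: "k = Suc i" using n by (cases k) auto
      have "v (Suc (i mod n)) = v (Suc i)" "v (Suc (Suc (i mod n))) = v (Suc (Suc i))"
        by (simp_all add: v_eq mod_Suc_eq mod_Suc_Suc_eq)
      moreover have "at_base (Suc i)" "in_copy E (Suc (Suc i))" using next_copy' k i by blast+
      ultimately show ?thesis using n
        by (intro exI[of _ "i mod n"]) (auto simp: at_base_def in_copy_def)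
    qed
    have leave: "\<exists>j. in_copy E j \<and> at_base (Suc j)" if E: "E \<in> ?\<E>" for E
    proof -
      obtain j where "in_copy E j" using E by blast
      moreover have "v (i0 + j * n) = v i0" by (simp add: v_eq)
      then have "\<not> in_copy E (i0 + j * n)" using i0 by (auto simp: in_copy_def at_base_def)
      moreover have "j \<le> i0 + j * n" using n by (simp add: trans_le_add2)
      ultimately obtain k where "in_copy E k" "\<not> in_copy E (Suc k)"
        using last_step_inside[of "in_copy E"] by blast
      then show ?thesis using next_copy by blast
    qed
    let ?B = "{i. i < n \<and> at_base (Suc i)}"
    have B: "?B \<subseteq> sources ?D v n"
      using arc by (auto simp: sources_def at_base_def descartes_simps) (metis arc descartes_simps(1))+
    have "card ?\<E> \<le> card (sources ?D v n)" and fin: "finite ?\<E>"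
    proof -
      obtain h where h: "\<And>E. E \<in> ?\<E> \<Longrightarrow> h E < n \<and> at_base (Suc (h E)) \<and> in_copy E (Suc (Suc (h E)))"
        using enter by metis
      have "inj_on h ?\<E>"
      proof (rule inj_onI)
        fix E E' assume EE': "E \<in> ?\<E>" "E' \<in> ?\<E>" "h E = h E'"
        then have "in_copy E (Suc (Suc (h E)))" "in_copy E' (Suc (Suc (h E)))"
          using h[OF EE'(1)] h[OF EE'(2)] by simp_all
        then show "E = E'" by (auto simp: in_copy_def)
      qed
      moreover have "h ` ?\<E> \<subseteq> sources ?D v n" using h B by auto
      moreover have "finite (sources ?D v n)" by (simp add: sources_def)
      ultimately show "card ?\<E> \<le> card (sources ?D v n)" "finite ?\<E>"
        by (auto intro: card_inj_on_le inj_on_finite)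
    qed
    moreover have "\<not> card ?\<E> \<le> b"
    proof
      assume few: "card ?\<E> \<le> b"
      have "\<not> at_base (Suc i0)"
        using arc[of i0] i0 by (auto simp: at_base_def descartes_simps)
      then have "?\<E> \<noteq> {}" using vertex by blast
      then have "card ?\<E> \<noteq> 0" using fin by simp
      have sub: "?\<E> \<subseteq> H"
      proof
        fix E assume "E \<in> ?\<E>"
        then show "E \<in> H" using enter[of E] around_base by (fastforce simp: at_base_def in_copy_def)
      qed
      have "\<exists>E\<in>?\<E>. leaf ?\<E> E"
      proof (cases "card ?\<E> = 1")
        case True
        then obtain E where "?\<E> = {E}" by (rule card_1_singletonE)
        then show ?thesis by (auto simp: leaf_def)
      next
        case False
        then have "2 \<le> card ?\<E>" using \<open>card ?\<E> \<noteq> 0\<close> by linarith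
        then show ?thesis using girth sub few unfolding high_girth_def by blast
      qed
      then obtain E x where E: "E \<in> ?\<E>" and x: "set E \<inter> \<Union>(set ` (?\<E> - {E})) \<subseteq> {x}"
        unfolding leaf_def by blast
      have EH: "E \<in> H" using E sub by blast
      \<comment> \<open>The cycle enters and leaves the copy at \<open>E\<close> through base vertices shared with other edges.
        Both are then the vertex \<open>x\<close>, so the cycle would turn back along the same arc.\<close>
      have shared: "y = x" if "E' \<in> ?\<E>" "E' \<noteq> E" "y \<in> set E" "y \<in> set E'" for E' y
        using that x by blast
      obtain i y where i: "v (Suc i) = base_vertex y" "in_copy E (Suc (Suc i))"
        using enter[OF E] by (auto simp: at_base_def)
      obtain E1 w1 w where iw: "E1 \<in> H" "w1 \<in> V" "w \<in> V" "v i = copy_vertex E1 w1"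
        "v (Suc (Suc i)) = copy_vertex E w" "y = E1 ! \<beta> w1" "y = E ! \<beta> w" "E1 \<noteq> E"
        using around_base[OF i(1)] i(2) by (fastforce simp: in_copy_def)
      have "E1 \<in> ?\<E>" using iw(4) by (auto simp: in_copy_def)
      then have "y = x" using shared[of E1 y] iw in_edge EH by metis
      obtain j z where j: "v (Suc j) = base_vertex z" "in_copy E j"
        using leave[OF E] by (auto simp: at_base_def)
      obtain E2 w2 w' where jw: "E2 \<in> H" "w2 \<in> V" "w' \<in> V" "v (Suc (Suc j)) = copy_vertex E2 w2"
        "v j = copy_vertex E w'" "z = E2 ! \<beta> w2" "z = E ! \<beta> w'" "E \<noteq> E2"
        using around_base[OF j(1)] j(2) by (fastforce simp: in_copy_def)
      have "E2 \<in> ?\<E>" using jw(4) by (auto simp: in_copy_def)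
      then have "z = x" using shared[of E2 z] jw in_edge EH by metis
      have "w' = w" using inj_edge[OF EH] iw(3,7) jw(3,7) \<open>y = x\<close> \<open>z = x\<close> by metis
      then have "v (Suc (Suc i)) = v j" "v (Suc i) = v (Suc j)"
        using iw(5) jw(5) i(1) j(1) \<open>y = x\<close> \<open>z = x\<close> by simp_all
      then have "Suc (Suc (Suc i)) mod n = Suc i mod n"
        using v_eq by (metis mod_Suc_eq)
      then show False using mod_Suc_Suc_neq[OF n] by blast
    qed
    ultimately show ?thesis by linarith
  qed
qed

lemma descartes_uncolourable:
  assumes H: "unavoidable (Suc c) H" "uniform (card V) H"
    and V: "finite V" "V \<noteq> {}" and \<beta>: "\<beta> ` V \<subseteq> {..<card V}" and A: "A \<subseteq> V \<times> V" "uncolourable c A"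
  shows "uncolourable (Suc c) (descartes H \<beta> V A)"
  unfolding uncolourable_def
proof (intro allI impI, rule ccontr)
  fix f :: "nat \<Rightarrow> nat" assume f: "\<forall>x. f x < Suc c"
  let ?D = "descartes H \<beta> V A"
  assume proper: "\<not> (\<exists>(x, y)\<in>?D. f x = f y)"
  have "\<forall>x. (f \<circ> base_vertex) x < Suc c" using f by simp
  then obtain E where E: "E \<in> H"
    "\<forall>x\<in>set E. \<forall>y\<in>set E. (f \<circ> base_vertex) x = (f \<circ> base_vertex) y"
    using H(1) unfolding unavoidable_def by meson
  have in_edge: "E ! \<beta> w \<in> set E" if "w \<in> V" for w
    using that H(2) E(1) \<beta> by (intro nth_mem) (auto simp: uniform_def)
  obtain w0 where w0: "w0 \<in> V" using V(2) by blast
  define k where "k = f (base_vertex (E ! \<beta> w0))"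
  have avoid: "f (copy_vertex E w) \<noteq> k" if "w \<in> V" for w
  proof -
    have "(base_vertex (E ! \<beta> w), copy_vertex E w) \<in> ?D" using that E(1) by (simp add: descartes_simps)
    then have "f (base_vertex (E ! \<beta> w)) \<noteq> f (copy_vertex E w)" using proper by blast
    moreover have "f (base_vertex (E ! \<beta> w)) = k"
      using bspec[OF bspec[OF E(2) in_edge[OF that]] in_edge[OF w0]] by (simp add: k_def)
    ultimately show ?thesis by simp
  qed
  \<comment> \<open>The colour \<open>k\<close> is free on the copy, so it can replace the last colour there.\<close>
  define g where "g w = (let w' = if w \<in> V then w else w0; a = f (copy_vertex E w') in if a = c then k else a)" for w
  have "g w < c" for w
  proof -
    let ?w = "if w \<in> V then w else w0"
    have "f (copy_vertex E ?w) < Suc c" "f (copy_vertex E ?w) \<noteq> k" "k < Suc c"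
      using f avoid w0 unfolding k_def by auto
    then show ?thesis by (auto simp: g_def Let_def)
  qed
  then obtain w w' where w: "(w, w') \<in> A" "g w = g w'" using A(2) unfolding uncolourable_def by blast
  then have "w \<in> V" "w' \<in> V" using A(1) by auto
  then have "f (copy_vertex E w) = f (copy_vertex E w')"
    using w(2) avoid[of w] avoid[of w'] by (auto simp: g_def Let_def split: if_splits)
  moreover have "(copy_vertex E w, copy_vertex E w') \<in> ?D" using w(1) E(1) by (simp add: descartes_simps)
  ultimately show False using proper by blast
qed

text \<open>
  The function \<open>r\<close> increases along arcs, which records acyclicity in a form that passes to the
  next step: the base vertices are put below all copies.
\<close>
lemma uncolourable_many_sources:
  "\<exists>(V::nat set) A (r::nat \<Rightarrow> nat). finite V \<and> V \<noteq> {} \<and> A \<subseteq> V \<times> V \<and> (\<forall>(x, y)\<in>A. r x < r y) \<and>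
     many_sources b A \<and> uncolourable c A"
proof (induction c)
  case 0
  have "many_sources b ({} :: (nat \<times> nat) set)" by (simp add: many_sources_def cycle_walk_def)
  moreover have "uncolourable 0 ({} :: (nat \<times> nat) set)" by (simp add: uncolourable_def)
  ultimately show ?case by (intro exI[of _ "{0}"] exI[of _ "{}"]) auto
next
  case (Suc c)
  then obtain V :: "nat set" and A and r :: "nat \<Rightarrow> nat" where IH: "finite V" "V \<noteq> {}" "A \<subseteq> V \<times> V"
    "\<forall>(x, y)\<in>A. r x < r y" "many_sources b A" "uncolourable c A" by blast
  obtain H :: "nat list set" where H: "finite H" "uniform (card V) H" "high_girth b H" "unavoidable (Suc c) H"
    using high_girth_unavoidable by blast
  obtain \<beta> where "bij_betw \<beta> V {..<card V}"
    using IH(1) by (metis ex_bij_betw_finite_nat lessThan_atLeast0)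
  then have \<beta>: "inj_on \<beta> V" "\<beta> ` V \<subseteq> {..<card V}" by (auto simp: bij_betw_def)
  let ?D = "descartes H \<beta> V A"
  let ?V = "insert 0 (Field ?D)"
  define \<rho> where "\<rho> x = (case (from_nat x :: nat + nat list \<times> nat) of Inl y \<Rightarrow> 0 | Inr (E, w) \<Rightarrow> Suc (r w))" for x
  have \<rho>: "\<rho> (base_vertex y) = 0" "\<rho> (copy_vertex E w) = Suc (r w)" for y E w
    by (auto simp: \<rho>_def base_vertex_def copy_vertex_def)
  have "finite A" using IH(1,3) by (meson finite_SigmaI finite_subset)
  then have "finite ?D" using H(1) IH(1) by (simp add: descartes_def)
  then have "finite ?V" by (simp add: finite_Field)
  moreover have "?D \<subseteq> ?V \<times> ?V" by (auto simp: Field_def)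
  moreover have "\<forall>(x, y)\<in>?D. \<rho> x < \<rho> y" using IH(4) by (auto simp: descartes_def \<rho>)
  ultimately show ?case
    using descartes_many_sources[OF H(3,2) \<beta> IH(5)] descartes_uncolourable[OF H(4,2) IH(1,2) \<beta>(2) IH(3,6)]
    by blast
qed

section \<open>Blocks and chromatic number\<close>

lemma tail_in_path:
  assumes "pre_digraph.cas (with_proj C) u p w" and "(s, t) \<in> set p"
  shows "s = u \<or> (\<exists>q. (q, s) \<in> set p)"
  using assms
proof (induction p arbitrary: u)
  case Nil
  then show ?case by simp
next
  case (Cons a p)
  have a: "fst a = u" "pre_digraph.cas (with_proj C) (snd a) p w"
    using Cons.prems(1) by (simp_all add: pre_digraph.cas.simps)
  show ?case
  proof (cases "(s, t) = a")
    case True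
    then show ?thesis using a(1) by auto
  next
    case False
    then have "s = snd a \<or> (\<exists>q. (q, s) \<in> set p)" using Cons.IH[OF a(2)] Cons.prems(2) by auto
    moreover have "(fst a, snd a) \<in> set (a # p)" by simp
    ultimately show ?thesis by (metis list.set_intros(2))
  qed
qed

text \<open>
  Each source is sent to a block that contains one of its two outgoing arcs. A directed path contains
  an outgoing arc of at most one source: every vertex of the path but the first has an incoming
  arc.
\<close>
lemma card_sources_le_card_blocks:
  assumes C: "finite (parcs C)" "antisym (parcs C)" "parcs C \<subseteq> pverts C \<times> pverts C"
    and loopless: "\<And>x. (x, x) \<notin> parcs C"
    and cyc: "cycle_walk (parcs C) v n" and edges: "\<And>x y. (x, y) \<in> parcs C \<Longrightarrow>
      \<exists>i. {x, y} = {v i, v (Suc i)}"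
  shows "card (sources (parcs C) v n) \<le> card (blocks C)"
proof -
  let ?A = "parcs C"
  have n: "3 \<le> n" and v_eq: "\<And>i j. v i = v j \<longleftrightarrow> i mod n = j mod n"
    using cyc by (auto simp: cycle_walk_def)
  have paths: "directed_subpaths C \<subseteq> Pow ?A"
    by (auto simp: directed_subpaths_def pre_digraph.apath_def pre_digraph.awalk_def)
  then have fin: "finite (directed_subpaths C)" using C(1) by (simp add: finite_subset)
  have block: "\<exists>P\<in>blocks C. (x, y) \<in> P" if xy: "(x, y) \<in> ?A" for x y
  proof -
    have "pre_digraph.apath (with_proj C) x [(x, y)] y"
      using xy C(3) loopless
      by (auto simp: pre_digraph.apath_def pre_digraph.awalk_def pre_digraph.cas.simps
          pre_digraph.awalk_verts.simps)
    then have "{(x, y)} \<in> directed_subpaths C"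
      unfolding directed_subpaths_def by force
    then obtain P where "P \<in> directed_subpaths C" "{(x, y)} \<subseteq> P"
      "\<forall>Q\<in>directed_subpaths C. P \<subseteq> Q \<longrightarrow> P = Q"
      using finite_has_maximal2[OF fin] by metis
    then show ?thesis by (auto simp: blocks_def)
  qed
  have no_in: "(q, v (Suc i)) \<notin> ?A" if i: "i \<in> sources ?A v n" for i q
  proof
    assume q: "(q, v (Suc i)) \<in> ?A"
    then obtain j where j: "{q, v (Suc i)} = {v j, v (Suc j)}" using edges by blast
    have out: "(v (Suc i), v i) \<in> ?A" "(v (Suc i), v (Suc (Suc i))) \<in> ?A"
      using i by (auto simp: sources_def)
    have "q \<noteq> v (Suc i)" using q loopless by blast
    then consider "v (Suc i) = v (Suc j)" "q = v j" | "v (Suc i) = v j" "q = v (Suc j)"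
      using j by (metis doubleton_eq_iff)
    then have "q = v i \<or> q = v (Suc (Suc i))"
    proof cases
      case 1
      then have "Suc (i + (n - 1)) mod n = Suc (j + (n - 1)) mod n"
        using v_eq[of "Suc i" "Suc j"] by (metis add_Suc mod_add_left_eq)
      then show ?thesis using 1 n v_eq[of i j] by simp
    next
      case 2
      then show ?thesis using v_eq[of "Suc i" j] v_eq[of "Suc (Suc i)" "Suc j"] by (metis mod_Suc_eq)
    qed
    then show False using q out C(2) \<open>q \<noteq> v (Suc i)\<close> by (metis antisymD)
  qed
  let ?S = "sources ?A v n"
  have "\<forall>i\<in>?S. \<exists>P\<in>blocks C. (v (Suc i), v (Suc (Suc i))) \<in> P"
    using block by (auto simp: sources_def)
  then obtain h where h: "\<And>i. i \<in> ?S \<Longrightarrow> h i \<in> blocks C \<and> (v (Suc i), v (Suc (Suc i))) \<in> h i"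
    by metis
  have "inj_on h ?S"
  proof (rule inj_onI)
    fix i j assume ij: "i \<in> ?S" "j \<in> ?S" "h i = h j"
    have "h i \<in> directed_subpaths C" using h[OF ij(1)] by (simp add: blocks_def)
    then obtain u p w where p: "h i = set p" "pre_digraph.apath (with_proj C) u p w"
      by (auto simp: directed_subpaths_def)
    then have cas: "pre_digraph.cas (with_proj C) u p w" and sub: "set p \<subseteq> ?A"
      by (auto simp: pre_digraph.apath_def pre_digraph.awalk_def)
    have first: "v (Suc k) = u" if "k \<in> ?S" "(v (Suc k), v (Suc (Suc k))) \<in> set p" for k
      using tail_in_path[OF cas that(2)] no_in[OF that(1)] sub by blast
    have "v (Suc i) = v (Suc j)" using first[OF ij(1)] first[OF ij(2)] h[OF ij(1)] h[OF ij(2)] ij(3) p(1) by simp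
    then have "Suc i mod n = Suc j mod n" using v_eq by blast
    moreover have "i < n" "j < n" using ij by (auto simp: sources_def)
    ultimately show "i = j" using n by (simp add: mod_Suc split: if_splits)
  qed
  moreover have "h ` ?S \<subseteq> blocks C" using h by blast
  moreover have "finite (blocks C)" using fin by (simp add: blocks_def)
  ultimately show ?thesis by (rule card_inj_on_le)
qed

lemma mk_symmetric_arc:
  "(x, y) \<in> parcs (mk_symmetric (with_proj D)) \<longleftrightarrow> (x, y) \<in> parcs D \<or> (y, x) \<in> parcs D"
  by (auto simp: parcs_mk_symmetric intro: bexI[of _ "(x, y)"] bexI[of _ "(y, x)"])

lemma oriented_cycle_walk:
  assumes "oriented_cycle C"
  obtains v n where "cycle_walk (parcs C) v n"
    and "\<And>x y. (x, y) \<in> parcs C \<Longrightarrow> \<exists>i. {x, y} = {v i, v (Suc i)}"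
proof -
  obtain vs where vs: "3 \<le> length vs" "distinct vs"
    "parcs (mk_symmetric (with_proj C)) = (\<Union>i<length vs.
         {(vs ! i, vs ! (Suc i mod length vs)), (vs ! (Suc i mod length vs), vs ! i)})"
    using assms unfolding oriented_cycle_def undirected_cycle_def by blast
  let ?n = "length vs"
  let ?v = "\<lambda>i. vs ! (i mod ?n)"
  have "cycle_walk (parcs C) ?v ?n"
    unfolding cycle_walk_def
  proof (intro conjI allI)
    show "3 \<le> ?n" by (rule vs(1))
    show "?v i = ?v j \<longleftrightarrow> i mod ?n = j mod ?n" for i j
      by (rule nth_eq_iff_index_eq[OF vs(2)]) (use vs(1) in \<open>auto intro!: mod_less_divisor\<close>)
    fix i
    have "0 < ?n" using vs(1) by linarith
    then have "i mod ?n < ?n" by (rule mod_less_divisor)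
    then have "(?v i, vs ! (Suc (i mod ?n) mod ?n)) \<in> parcs (mk_symmetric (with_proj C))"
      unfolding vs(3) by blast
    then show "(?v i, ?v (Suc i)) \<in> parcs C \<or> (?v (Suc i), ?v i) \<in> parcs C"
      by (simp add: mk_symmetric_arc mod_Suc_eq)
  qed
  moreover have "\<exists>i. {x, y} = {?v i, ?v (Suc i)}" if "(x, y) \<in> parcs C" for x y
  proof -
    have "(x, y) \<in> parcs (mk_symmetric (with_proj C))" using that mk_symmetric_arc by fast
    then obtain i where i: "i < ?n" "{x, y} = {vs ! i, vs ! (Suc i mod ?n)}" unfolding vs(3) by auto
    then show ?thesis by (intro exI[of _ i]) simp
  qed
  ultimately show ?thesis by (rule that)
qed

lemma acyclic_digraph_if_rank:
  fixes r :: "'a \<Rightarrow> nat"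
  assumes "\<And>x y. (x, y) \<in> parcs D \<Longrightarrow> r x < r y"
  shows "acyclic_digraph D"
proof -
  have "p = [] \<and> u = w \<or> r u < r w"
    if "pre_digraph.cas (with_proj D) u p w" "set p \<subseteq> parcs D" for u p w
    using that
  proof (induction p arbitrary: u)
    case Nil
    then show ?case by (simp add: pre_digraph.cas.simps)
  next
    case (Cons a p)
    then have "fst a = u" "pre_digraph.cas (with_proj D) (snd a) p w" "r (fst a) < r (snd a)"
      using assms[of "fst a" "snd a"] by (auto simp: pre_digraph.cas.simps)
    then show ?case using Cons.IH[of "snd a"] Cons.prems(2) by auto
  qed
  then show ?thesis
    unfolding acyclic_digraph_def pre_digraph.cycle_def pre_digraph.awalk_def by fastforce
qed

lemma chromatic_number_ge:
  assumes "finite (pverts D)" "parcs D \<subseteq> pverts D \<times> pverts D" "\<And>x. (x, x) \<notin> parcs D"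
    and "uncolourable c (parcs D)" "0 < c"
  shows "c \<le> digraph_chromatic_number D"
proof -
  let ?G = "mk_symmetric (with_proj D)"
  have verts: "pverts ?G = pverts D" by (simp add: mk_symmetric_def)
  obtain h where "bij_betw h (pverts D) {0..<card (pverts D)}"
    using ex_bij_betw_finite_nat[OF assms(1)] by blast
  then have h: "inj_on h (pverts D)" "\<And>x. x \<in> pverts D \<Longrightarrow> h x < card (pverts D)"
    by (auto simp: bij_betw_def)
  have arc_neq: "h x \<noteq> h y" if "(x, y) \<in> parcs D" for x y
    using that h(1) assms(2,3) by (metis inj_onD mem_Sigma_iff subsetD)
  have "proper_colouring ?G (card (pverts D)) h"
    unfolding proper_colouring_def verts
    using h(2) arc_neq arc_neq[symmetric] by (auto simp: mk_symmetric_arc)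
  then have "\<exists>k f. proper_colouring ?G k f" by blast
  then have "\<exists>f. proper_colouring ?G (digraph_chromatic_number D) f"
    unfolding digraph_chromatic_number_def graph_chromatic_number_def by (rule LeastI_ex)
  then obtain f where f: "proper_colouring ?G (digraph_chromatic_number D) f" by blast
  show ?thesis
  proof (rule ccontr)
    assume less: "\<not> ?thesis"
    let ?f = "\<lambda>x. if x \<in> pverts D then f x else 0"
    have "\<forall>x. ?f x < c" using f less assms(5) unfolding proper_colouring_def verts by fastforce
    then have "\<exists>(x, y)\<in>parcs D. ?f x = ?f y"
      by (rule assms(4)[unfolded uncolourable_def, THEN spec, THEN mp])
    then obtain x y where "(x, y) \<in> parcs D" "?f x = ?f y" by blast
    moreover from this have "x \<in> pverts D" "y \<in> pverts D" using assms(2) by auto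
    ultimately show False using f mk_symmetric_arc[of x y D] unfolding proper_colouring_def by auto
  qed
qed

theorem theorem20:
  fixes b c :: nat
  assumes "0 < b" and "0 < c"
  shows "\<exists>D :: nat pair_pre_digraph.
           pair_digraph D \<and> acyclic_digraph D \<and> c \<le> digraph_chromatic_number D \<and>
           (\<forall>C. oriented_cycle C \<and> subgraph (with_proj C) (with_proj D) \<longrightarrow> b < card (blocks C))"
proof -
  obtain V :: "nat set" and A and r :: "nat \<Rightarrow> nat" where D: "finite V" "A \<subseteq> V \<times> V"
    "\<forall>(x, y)\<in>A. r x < r y" "many_sources b A" "uncolourable c A"
    using uncolourable_many_sources[of b c] by blast
  let ?D = "\<lparr> pverts = V, parcs = A \<rparr>"
  have rank: "r x < r y" if "(x, y) \<in> A" for x y using D(3) that by blast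
  then have loopless: "(x, x) \<notin> A" for x by blast
  have finA: "finite A" using D(1,2) by (meson finite_SigmaI finite_subset)
  have "pair_digraph ?D"
    by unfold_locales (use D(1,2) finA loopless in auto)
  moreover have "acyclic_digraph ?D" by (rule acyclic_digraph_if_rank[of _ r]) (simp add: rank)
  moreover have "c \<le> digraph_chromatic_number ?D"
    by (rule chromatic_number_ge) (use D(1,2,5) loopless assms(2) in auto)
  moreover have "b < card (blocks C)" if C: "oriented_cycle C" "subgraph (with_proj C) (with_proj ?D)" for C
  proof -
    have sub: "parcs C \<subseteq> A" and wf: "wf_digraph (with_proj C)" using C(2) by (auto simp: subgraph_def)
    obtain v n where v: "cycle_walk (parcs C) v n"
      "\<And>x y. (x, y) \<in> parcs C \<Longrightarrow> \<exists>i. {x, y} = {v i, v (Suc i)}"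
      using oriented_cycle_walk[OF C(1)] by blast
    have step: "(v i, v (Suc i)) \<in> parcs C \<or> (v (Suc i), v i) \<in> parcs C" for i
      using v(1) by (auto simp: cycle_walk_def)
    have "cycle_walk A v n" using v(1) sub by (auto simp: cycle_walk_def)
    then have "b < card (sources A v n)" using D(4) by (simp add: many_sources_def)
    moreover have asym: "(y, x) \<notin> A" if "(x, y) \<in> A" for x y using rank that by (meson less_asym)
    have "sources A v n \<subseteq> sources (parcs C) v n"
      unfolding sources_def using step sub asym by blast
    then have "card (sources A v n) \<le> card (sources (parcs C) v n)"
      by (rule card_mono[rotated]) (simp add: sources_def)
    moreover have "card (sources (parcs C) v n) \<le> card (blocks C)"
    proof (rule card_sources_le_card_blocks[OF _ _ _ _ v])
      show "finite (parcs C)" using sub finA by (rule finite_subset)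
      show "antisym (parcs C)" using C(1) by (simp add: oriented_cycle_def)
      show "parcs C \<subseteq> pverts C \<times> pverts C"
        using wf_digraph.tail_in_verts[OF wf] wf_digraph.head_in_verts[OF wf] by fastforce
      show "(x, x) \<notin> parcs C" for x using sub loopless by blast
    qed
    ultimately show ?thesis by linarith
  qed
  ultimately show ?thesis by blast
qed

end
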